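(* Let $G$ be a first-order structure expanding a group, $T$ its complete theory, and $\mathbb{G}$ a sufficiently saturated monster model of $T$. If a formula $\varphi(x)$ with parameters from $G$ is gs-substantial, then it has the finitary productset property: for every $n\in\mathbb{N}$ there are $B,C\subseteq G$ with $|B|,|C|\geq n$ and $B\cdot C\subseteq\varphi(G)$.
   Context: For a small model $M\prec\mathbb{G}$, a global type $p\in S_1(\mathbb{G})$ is generically stable over $M$ if it is $M$-invariant and, for any Morley sequence $(b_i)_{i<\omega}$ in $p$ over $M$ (i.e. $b_i$ realizes $p$ restricted to $M\cup\{b_j:j<i\}$) and any formula $\theta(x)$ with parameters from $\mathbb{G}$, the set $\{i<\omega:\mathbb{G}\models\theta(b_i)\}$ is finite or cofinite. $\varphi(x)$ is gs-substantial if there are a small model $M\prec\mathbb{G}$ and $b,c\in\mathbb{G}\setminus M$ such that $\mathbb{G}\models\varphi(b\cdot c)$ and $\mathrm{tp}(b/Gc)$ extends to a nonalgebraic global type which is generically stable over $M$.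
   Formalization: In the definition of gs-substantial, the small model M is additionally required to contain the parameters of φ (as when M contains G); for arbitrary M the claim fails, e.g. for P(x−c) with M=(ℤ,+,P), P the powers of 2, G a proper elementary extension of M, and c in G∖M. *)

theory Defs
  imports "HOL-Algebra.Coset"
begin

unbundle cardinal_syntax

section \<open>First-order languages, structures and formulas with parameters\<close>

record ('f, 'r) language =
  funs :: "'f set"
  rels :: "'r set"
  farity :: "'f \<Rightarrow> nat"
  rarity :: "'r \<Rightarrow> nat"

record ('a, 'f, 'r) fo_struct = "'a partial_object" +
  fn :: "'f \<Rightarrow> 'a list \<Rightarrow> 'a"
  rl :: "'r \<Rightarrow> 'a list \<Rightarrow> bool"

definition is_structure ::
  "('f, 'r) language \<Rightarrow> ('a, 'f, 'r) fo_struct \<Rightarrow> bool" where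
  "is_structure L S \<longleftrightarrow> carrier S \<noteq> {} \<and>
     (\<forall>f\<in>funs L. \<forall>xs. set xs \<subseteq> carrier S \<longrightarrow> length xs = farity L f \<longrightarrow> fn S f xs \<in> carrier S)"

text \<open>The constructor \<open>Par a\<close> is the constant symbol naming the element \<open>a\<close>, so the
  formulas whose parameters all lie in \<open>A\<close> are the formulas of the expanded language
  \<open>L(A)\<close>, and \<open>map_fm id id \<sigma>\<close> is the action of a map \<open>\<sigma>\<close> on parameters.\<close>

datatype (tfuns: 'f, tpars: 'a) tm = Var nat | Par 'a | App 'f "('f, 'a) tm list"

datatype (ffuns: 'f, frels: 'r, pars: 'a) fm =
    Eq "('f, 'a) tm" "('f, 'a) tm"
  | Rel 'r "('f, 'a) tm list"
  | Neg "('f, 'r, 'a) fm"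
  | And "('f, 'r, 'a) fm" "('f, 'r, 'a) fm"
  | Ex nat "('f, 'r, 'a) fm"

fun wf_tm :: "('f, 'r) language \<Rightarrow> ('f, 'a) tm \<Rightarrow> bool" where
  "wf_tm L (Var n) \<longleftrightarrow> True"
| "wf_tm L (Par a) \<longleftrightarrow> True"
| "wf_tm L (App f ts) \<longleftrightarrow> f \<in> funs L \<and> length ts = farity L f \<and> (\<forall>t\<in>set ts. wf_tm L t)"

fun wf_fm :: "('f, 'r) language \<Rightarrow> ('f, 'r, 'a) fm \<Rightarrow> bool" where
  "wf_fm L (Eq s t) \<longleftrightarrow> wf_tm L s \<and> wf_tm L t"
| "wf_fm L (Rel r ts) \<longleftrightarrow> r \<in> rels L \<and> length ts = rarity L r \<and> (\<forall>t\<in>set ts. wf_tm L t)"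
| "wf_fm L (Neg \<phi>) \<longleftrightarrow> wf_fm L \<phi>"
| "wf_fm L (And \<phi> \<psi>) \<longleftrightarrow> wf_fm L \<phi> \<and> wf_fm L \<psi>"
| "wf_fm L (Ex n \<phi>) \<longleftrightarrow> wf_fm L \<phi>"

fun fv_tm :: "('f, 'a) tm \<Rightarrow> nat set" where
  "fv_tm (Var n) = {n}"
| "fv_tm (Par a) = {}"
| "fv_tm (App f ts) = (\<Union>t\<in>set ts. fv_tm t)"

fun fv :: "('f, 'r, 'a) fm \<Rightarrow> nat set" where
  "fv (Eq s t) = fv_tm s \<union> fv_tm t"
| "fv (Rel r ts) = (\<Union>t\<in>set ts. fv_tm t)"
| "fv (Neg \<phi>) = fv \<phi>"
| "fv (And \<phi> \<psi>) = fv \<phi> \<union> fv \<psi>"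
| "fv (Ex n \<phi>) = fv \<phi> - {n}"

fun eval_tm :: "('a, 'f, 'r) fo_struct \<Rightarrow> (nat \<Rightarrow> 'a) \<Rightarrow> ('f, 'a) tm \<Rightarrow> 'a" where
  "eval_tm S v (Var n) = v n"
| "eval_tm S v (Par a) = a"
| "eval_tm S v (App f ts) = fn S f (map (eval_tm S v) ts)"

fun sat :: "('a, 'f, 'r) fo_struct \<Rightarrow> (nat \<Rightarrow> 'a) \<Rightarrow> ('f, 'r, 'a) fm \<Rightarrow> bool" where
  "sat S v (Eq s t) \<longleftrightarrow> eval_tm S v s = eval_tm S v t"
| "sat S v (Rel r ts) \<longleftrightarrow> rl S r (map (eval_tm S v) ts)"
| "sat S v (Neg \<phi>) \<longleftrightarrow> \<not> sat S v \<phi>"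
| "sat S v (And \<phi> \<psi>) \<longleftrightarrow> sat S v \<phi> \<and> sat S v \<psi>"
| "sat S v (Ex n \<phi>) \<longleftrightarrow> (\<exists>a\<in>carrier S. sat S (v(n := a)) \<phi>)"

definition sentences :: "('f, 'r) language \<Rightarrow> 'a set \<Rightarrow> ('f, 'r, 'a) fm set" where
  "sentences L A = {\<phi>. wf_fm L \<phi> \<and> pars \<phi> \<subseteq> A \<and> fv \<phi> = {}}"

text \<open>\<open>formulas_x L A\<close> is the set of \<open>L(A)\<close>-formulas \<open>\<phi>(x)\<close>; the variable \<open>x\<close> is
  \<open>Var 0\<close> throughout.\<close>

definition formulas_x :: "('f, 'r) language \<Rightarrow> 'a set \<Rightarrow> ('f, 'r, 'a) fm set" where
  "formulas_x L A = {\<phi>. wf_fm L \<phi> \<and> pars \<phi> \<subseteq> A \<and> fv \<phi> \<subseteq> {0}}"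

definition models :: "('a, 'f, 'r) fo_struct \<Rightarrow> ('f, 'r, 'a) fm \<Rightarrow> bool" where
  "models S \<phi> \<longleftrightarrow> (\<forall>v. range v \<subseteq> carrier S \<longrightarrow> sat S v \<phi>)"

definition holds_at :: "('a, 'f, 'r) fo_struct \<Rightarrow> ('f, 'r, 'a) fm \<Rightarrow> 'a \<Rightarrow> bool" where
  "holds_at S \<phi> a \<longleftrightarrow> sat S (\<lambda>_. a) \<phi>"

definition solutions :: "('a, 'f, 'r) fo_struct \<Rightarrow> ('f, 'r, 'a) fm \<Rightarrow> 'a set" where
  "solutions S \<phi> = {a \<in> carrier S. holds_at S \<phi> a}"

definition theory_of ::
  "('f, 'r) language \<Rightarrow> ('a, 'f, 'r) fo_struct \<Rightarrow> ('f, 'r, 'a) fm set" where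
  "theory_of L S = {\<phi> \<in> sentences L {}. models S \<phi>}"

definition substructure ::
  "('f, 'r) language \<Rightarrow> ('a, 'f, 'r) fo_struct \<Rightarrow> ('a, 'f, 'r) fo_struct \<Rightarrow> bool" where
  "substructure L M N \<longleftrightarrow> is_structure L M \<and> is_structure L N \<and> carrier M \<subseteq> carrier N \<and>
     (\<forall>f\<in>funs L. \<forall>xs. set xs \<subseteq> carrier M \<longrightarrow> length xs = farity L f \<longrightarrow> fn M f xs = fn N f xs) \<and>
     (\<forall>r\<in>rels L. \<forall>xs. set xs \<subseteq> carrier M \<longrightarrow> length xs = rarity L r \<longrightarrow> rl M r xs = rl N r xs)"

definition elem_substructure ::
  "('f, 'r) language \<Rightarrow> ('a, 'f, 'r) fo_struct \<Rightarrow> ('a, 'f, 'r) fo_struct \<Rightarrow> bool" where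
  "elem_substructure L M N \<longleftrightarrow> substructure L M N \<and>
     (\<forall>\<phi>\<in>sentences L (carrier M). models M \<phi> \<longleftrightarrow> models N \<phi>)"

definition automorphism ::
  "('f, 'r) language \<Rightarrow> ('a, 'f, 'r) fo_struct \<Rightarrow> ('a \<Rightarrow> 'a) \<Rightarrow> bool" where
  "automorphism L S \<sigma> \<longleftrightarrow> bij_betw \<sigma> (carrier S) (carrier S) \<and>
     (\<forall>f\<in>funs L. \<forall>xs. set xs \<subseteq> carrier S \<longrightarrow> length xs = farity L f \<longrightarrow>
        \<sigma> (fn S f xs) = fn S f (map \<sigma> xs)) \<and>
     (\<forall>r\<in>rels L. \<forall>xs. set xs \<subseteq> carrier S \<longrightarrow> length xs = rarity L r \<longrightarrow>
        rl S r (map \<sigma> xs) = rl S r xs)"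

section \<open>Types and monster models\<close>

text \<open>The space \<open>S\<^sub>1(A)\<close> of complete 1-types over \<open>A\<close>, computed in \<open>S\<close>.\<close>

definition types_over ::
  "('f, 'r) language \<Rightarrow> ('a, 'f, 'r) fo_struct \<Rightarrow> 'a set \<Rightarrow> ('f, 'r, 'a) fm set set" where
  "types_over L S A = {p. p \<subseteq> formulas_x L A \<and>
     (\<forall>q. finite q \<longrightarrow> q \<subseteq> p \<longrightarrow> (\<exists>a\<in>carrier S. \<forall>\<phi>\<in>q. holds_at S \<phi> a)) \<and>
     (\<forall>\<phi>\<in>formulas_x L A. \<phi> \<in> p \<or> Neg \<phi> \<in> p)}"

definition tp ::
  "('f, 'r) language \<Rightarrow> ('a, 'f, 'r) fo_struct \<Rightarrow> 'a \<Rightarrow> 'a set \<Rightarrow> ('f, 'r, 'a) fm set" where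
  "tp L S b A = {\<phi> \<in> formulas_x L A. holds_at S \<phi> b}"

definition restrict_type ::
  "('f, 'r) language \<Rightarrow> ('f, 'r, 'a) fm set \<Rightarrow> 'a set \<Rightarrow> ('f, 'r, 'a) fm set" where
  "restrict_type L p A = p \<inter> formulas_x L A"

definition realizes ::
  "('a, 'f, 'r) fo_struct \<Rightarrow> 'a \<Rightarrow> ('f, 'r, 'a) fm set \<Rightarrow> bool" where
  "realizes S b p \<longleftrightarrow> b \<in> carrier S \<and> (\<forall>\<phi>\<in>p. holds_at S \<phi> b)"

definition nonalgebraic ::
  "('a, 'f, 'r) fo_struct \<Rightarrow> ('f, 'r, 'a) fm set \<Rightarrow> bool" where
  "nonalgebraic S p \<longleftrightarrow> (\<forall>\<phi>\<in>p. infinite (solutions S \<phi>))"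

definition small :: "'k rel \<Rightarrow> 'a set \<Rightarrow> bool" where
  "small k A \<longleftrightarrow> |A| <o k"

definition saturated ::
  "('f, 'r) language \<Rightarrow> 'k rel \<Rightarrow> ('a, 'f, 'r) fo_struct \<Rightarrow> bool" where
  "saturated L k S \<longleftrightarrow> (\<forall>A. A \<subseteq> carrier S \<longrightarrow> small k A \<longrightarrow>
     (\<forall>p\<in>types_over L S A. \<exists>b. realizes S b p))"

definition partial_elementary ::
  "('f, 'r) language \<Rightarrow> ('a, 'f, 'r) fo_struct \<Rightarrow> 'a set \<Rightarrow> ('a \<Rightarrow> 'a) \<Rightarrow> bool" where
  "partial_elementary L S A h \<longleftrightarrow> A \<subseteq> carrier S \<and> h ` A \<subseteq> carrier S \<and>
     (\<forall>\<phi>\<in>sentences L A. models S \<phi> \<longleftrightarrow> models S (map_fm id id h \<phi>))"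

definition strongly_homogeneous ::
  "('f, 'r) language \<Rightarrow> 'k rel \<Rightarrow> ('a, 'f, 'r) fo_struct \<Rightarrow> bool" where
  "strongly_homogeneous L k S \<longleftrightarrow> (\<forall>A h. small k A \<longrightarrow> partial_elementary L S A h \<longrightarrow>
     (\<exists>\<sigma>. automorphism L S \<sigma> \<and> (\<forall>a\<in>A. \<sigma> a = h a)))"

text \<open>``Sufficiently saturated'' means saturated and strongly homogeneous with respect to an
  uncountable cardinal \<open>k\<close> larger than the language; ``small'' means of cardinality
  less than \<open>k\<close>.\<close>

definition monster_model ::
  "('f, 'r) language \<Rightarrow> 'k rel \<Rightarrow> ('f, 'r, 'a) fm set \<Rightarrow> ('a, 'f, 'r) fo_struct \<Rightarrow> bool" where
  "monster_model L k T S \<longleftrightarrow>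
     Card_order k \<and> natLeq <o k \<and> small k (funs L) \<and> small k (rels L) \<and>
     is_structure L S \<and> (\<forall>\<phi>\<in>T. models S \<phi>) \<and>
     saturated L k S \<and> strongly_homogeneous L k S"

section \<open>Generically stable types\<close>

definition invariant_over ::
  "('f, 'r) language \<Rightarrow> ('a, 'f, 'r) fo_struct \<Rightarrow> 'a set \<Rightarrow> ('f, 'r, 'a) fm set \<Rightarrow> bool" where
  "invariant_over L S A p \<longleftrightarrow> (\<forall>\<sigma>. automorphism L S \<sigma> \<longrightarrow> (\<forall>a\<in>A. \<sigma> a = a) \<longrightarrow>
     map_fm id id \<sigma> ` p = p)"

definition morley_sequence ::
  "('f, 'r) language \<Rightarrow> ('a, 'f, 'r) fo_struct \<Rightarrow> 'a set \<Rightarrow> ('f, 'r, 'a) fm set \<Rightarrow>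
   (nat \<Rightarrow> 'a) \<Rightarrow> bool" where
  "morley_sequence L S A p b \<longleftrightarrow>
     (\<forall>i. realizes S (b i) (restrict_type L p (A \<union> {b j |j. j < i})))"

definition generically_stable ::
  "('f, 'r) language \<Rightarrow> ('a, 'f, 'r) fo_struct \<Rightarrow> 'a set \<Rightarrow> ('f, 'r, 'a) fm set \<Rightarrow> bool" where
  "generically_stable L S A p \<longleftrightarrow> invariant_over L S A p \<and>
     (\<forall>b. morley_sequence L S A p b \<longrightarrow>
       (\<forall>\<theta>\<in>formulas_x L (carrier S).
          finite {i. holds_at S \<theta> (b i)} \<or> finite (- {i. holds_at S \<theta> (b i)})))"

section \<open>Expansions of groups\<close>

text \<open>The group operation is a distinguished binary symbol \<open>m\<close> of the language; the symbols
  for the identity and the inverse may or may not belong to the language.\<close>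

definition group_reduct ::
  "'f \<Rightarrow> ('a, 'f, 'r) fo_struct \<Rightarrow> 'a monoid" where
  "group_reduct m S =
     \<lparr>carrier = carrier S,
      mult = (\<lambda>x y. fn S m [x, y]),
      one = (THE e. e \<in> carrier S \<and> (\<forall>x\<in>carrier S. fn S m [e, x] = x \<and> fn S m [x, e] = x))\<rparr>"

definition expands_group ::
  "('f, 'r) language \<Rightarrow> 'f \<Rightarrow> ('a, 'f, 'r) fo_struct \<Rightarrow> bool" where
  "expands_group L m S \<longleftrightarrow> is_structure L S \<and> m \<in> funs L \<and> farity L m = 2 \<and>
     Group.group (group_reduct m S)"

text \<open>The condition \<open>pars \<phi> \<subseteq> carrier M\<close> says that \<open>\<phi>\<close> is over \<open>M\<close>; it holds in particular
  whenever \<open>M\<close> contains \<open>G\<close>. It cannot be dropped. Let \<open>G\<close> be a proper elementary extension of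
  \<open>M = (\<int>, +, P)\<close> with \<open>P\<close> the powers of 2, let \<open>c \<in> G - M\<close>, and let \<open>\<phi>(x)\<close> be
  \<open>P(x - c)\<close>. Since the theory is stable, every \<open>M\<close>-invariant global type is generically stable
  over \<open>M\<close>, and a nonalgebraic one containing \<open>P(x)\<close> would witness that \<open>\<phi>\<close> is gs-substantial,
  although no translate of \<open>P\<close> contains a sum of two sets of size 2.\<close>

definition gs_substantial ::
  "('f, 'r) language \<Rightarrow> 'f \<Rightarrow> 'k rel \<Rightarrow> ('a, 'f, 'r) fo_struct \<Rightarrow> ('a, 'f, 'r) fo_struct \<Rightarrow>
   ('f, 'r, 'a) fm \<Rightarrow> bool" where
  "gs_substantial L m k G GG \<phi> \<longleftrightarrow>
     (\<exists>M. elem_substructure L M GG \<and> small k (carrier M) \<and> pars \<phi> \<subseteq> carrier M \<and>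
       (\<exists>b\<in>carrier GG - carrier M. \<exists>c\<in>carrier GG - carrier M.
          holds_at GG \<phi> (b \<otimes>\<^bsub>group_reduct m GG\<^esub> c) \<and>
          (\<exists>p\<in>types_over L GG (carrier GG).
             tp L GG b (carrier G \<union> {c}) \<subseteq> p \<and> nonalgebraic GG p \<and>
             generically_stable L GG (carrier M) p)))"

definition finitary_productset_property ::
  "'f \<Rightarrow> ('a, 'f, 'r) fo_struct \<Rightarrow> ('f, 'r, 'a) fm \<Rightarrow> bool" where
  "finitary_productset_property m G \<phi> \<longleftrightarrow>
     (\<forall>n::nat. \<exists>B C. B \<subseteq> carrier G \<and> C \<subseteq> carrier G \<and>
        (infinite B \<or> n \<le> card B) \<and> (infinite C \<or> n \<le> card C) \<and>
        B <#>\<^bsub>group_reduct m G\<^esub> C \<subseteq> solutions G \<phi>)"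

end

theory Submission
  imports Defs
begin

text \<open>Since \<open>c \<notin> M\<close>, the type of \<open>c\<close> over \<open>M\<close> is not algebraic, so by saturation it has
  infinitely many realizations, all conjugate to \<open>c\<close> over \<open>M\<close> by strong homogeneity. By
  invariance \<open>p\<close> contains \<open>\<phi>(x \<cdot> c')\<close> for each such \<open>c'\<close>, hence every finite
  conjunction of these formulas, which has infinitely many solutions because \<open>p\<close> is
  nonalgebraic. This yields arbitrarily large finite productsets in the monster model, and they
  are pulled back to \<open>G\<close> by elementarity.\<close>

section \<open>Syntax\<close>

lemma eval_tm_cong: "(\<And>i. i \<in> fv_tm t \<Longrightarrow> v i = w i) \<Longrightarrow> eval_tm S v t = eval_tm S w t"
proof (induction t)
  case (App f ts)
  then have "map (eval_tm S v) ts = map (eval_tm S w) ts" by auto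
  then show ?case by (metis eval_tm.simps(3))
qed auto

lemma sat_cong: "(\<And>i. i \<in> fv \<chi> \<Longrightarrow> v i = w i) \<Longrightarrow> sat S v \<chi> \<longleftrightarrow> sat S w \<chi>"
proof (induction \<chi> arbitrary: v w)
  case (Eq s t)
  then show ?case using eval_tm_cong[of s v w S] eval_tm_cong[of t v w S] by auto
next
  case (Rel r ts)
  then have "map (eval_tm S v) ts = map (eval_tm S w) ts"
    by (auto intro!: eval_tm_cong)
  then show ?case by (metis sat.simps(2))
next
  case (Neg \<chi>)
  have "sat S v \<chi> = sat S w \<chi>" by (rule Neg.IH) (use Neg.prems in simp)
  then show ?case by simp
next
  case (And \<chi> \<psi>)
  have "sat S v \<chi> = sat S w \<chi>" by (rule And.IH(1)) (use And.prems in simp)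
  moreover have "sat S v \<psi> = sat S w \<psi>" by (rule And.IH(2)) (use And.prems in simp)
  ultimately show ?case by simp
next
  case (Ex n \<chi>)
  have "sat S (v(n := a)) \<chi> = sat S (w(n := a)) \<chi>" for a
    by (rule Ex.IH) (use Ex.prems in auto)
  then show ?case by simp
qed

text \<open>With no free variables, \<open>sat_cong\<close> makes the assignment irrelevant. The
  condition on \<open>range v\<close> matches \<open>models\<close>, which tests only assignments
  into the carrier.\<close>

lemma sat_sentence:
  assumes "\<chi> \<in> sentences L A" and "range v \<subseteq> carrier S"
  shows "sat S v \<chi> \<longleftrightarrow> models S \<chi>"
  using assms sat_cong[of \<chi>] unfolding sentences_def models_def by blast

text \<open>Shifting bound variables along with the free ones leaves the variables below \<open>N\<close> unused, so
  that \<open>Var 0\<close> can replace the parameters in \<open>D\<close> without capture (if \<open>N > 0\<close>).\<close>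

fun raise_tm :: "nat \<Rightarrow> 'a set \<Rightarrow> ('f, 'a) tm \<Rightarrow> ('f, 'a) tm" where
  "raise_tm N D (Var i) = Var (i + N)"
| "raise_tm N D (Par a) = (if a \<in> D then Var 0 else Par a)"
| "raise_tm N D (App f ts) = App f (map (raise_tm N D) ts)"

fun raise :: "nat \<Rightarrow> 'a set \<Rightarrow> ('f, 'r, 'a) fm \<Rightarrow> ('f, 'r, 'a) fm" where
  "raise N D (Eq s t) = Eq (raise_tm N D s) (raise_tm N D t)"
| "raise N D (Rel r ts) = Rel r (map (raise_tm N D) ts)"
| "raise N D (Neg \<chi>) = Neg (raise N D \<chi>)"
| "raise N D (And \<chi> \<psi>) = And (raise N D \<chi>) (raise N D \<psi>)"
| "raise N D (Ex n \<chi>) = Ex (n + N) (raise N D \<chi>)"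

lemma eval_raise_tm:
  "eval_tm S v (raise_tm N D t) =
     eval_tm S (\<lambda>i. v (i + N)) (map_tm id (\<lambda>a. if a \<in> D then v 0 else a) t)"
proof (induction t)
  case (App f ts)
  then have "map (eval_tm S v \<circ> raise_tm N D) ts =
    map (eval_tm S (\<lambda>i. v (i + N)) \<circ> map_tm id (\<lambda>a. if a \<in> D then v 0 else a)) ts"
    by (auto simp: id_def)
  then show ?case
    unfolding raise_tm.simps tm.map eval_tm.simps map_map id_apply by (simp only:)
qed auto

text \<open>The one danger is a quantifier overwriting \<open>v 0\<close>, the value standing for
  the parameters in \<open>D\<close>. Quantifiers act on indices \<open>n + N\<close>, so this
  cannot happen if \<open>0 < N\<close>, and it is harmless if \<open>D = {}\<close>.\<close>

lemma sat_raise: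
  assumes "0 < N \<or> D = {}"
  shows "sat S v (raise N D \<chi>) \<longleftrightarrow>
     sat S (\<lambda>i. v (i + N)) (map_fm id id (\<lambda>a. if a \<in> D then v 0 else a) \<chi>)"
proof (induction \<chi> arbitrary: v)
  case (Rel r ts)
  show ?case by (simp add: eval_raise_tm comp_def id_def)
next
  case (Ex n \<chi>)
  have "sat S (v(n + N := a)) (raise N D \<chi>) \<longleftrightarrow>
      sat S ((\<lambda>i. v (i + N))(n := a)) (map_fm id id (\<lambda>b. if b \<in> D then v 0 else b) \<chi>)" for a
  proof -
    have *: "(\<lambda>b. if b \<in> D then (v(n + N := a)) 0 else b) = (\<lambda>b. if b \<in> D then v 0 else b)"
      using assms by auto
    have "(\<lambda>i. (v(n + N := a)) (i + N)) = (\<lambda>i. v (i + N))(n := a)"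
      by auto
    from Ex.IH[of "v(n + N := a)", unfolded this *] show ?thesis .
  qed
  then show ?case by (simp add: id_def)
qed (simp_all add: eval_raise_tm id_def)

section \<open>Well-formedness, parameters and free variables under shifts and parameter
  maps\<close>

lemma wf_raise_tm: "wf_tm L (raise_tm N D t) \<longleftrightarrow> wf_tm L t"
  by (induction t) auto

lemma wf_raise: "wf_fm L (raise N D \<chi>) \<longleftrightarrow> wf_fm L \<chi>"
  by (induction \<chi>) (auto simp: wf_raise_tm)

lemma tpars_raise_tm: "tpars (raise_tm N D t) = tpars t - D"
  by (induction t) auto

lemma pars_raise: "pars (raise N D \<chi>) = pars \<chi> - D"
  by (induction \<chi>) (auto simp: tpars_raise_tm)

lemma fv_raise_tm: "fv_tm (raise_tm N D t) \<subseteq> (\<lambda>i. i + N) ` fv_tm t \<union> (if D = {} then {} else {0})"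
proof (induction t)
  case (App f ts)
  have "fv_tm (raise_tm N D t) \<subseteq> (\<lambda>i. i + N) ` fv_tm (App f ts) \<union> (if D = {} then {} else {0})"
    if "t \<in> set ts" for t
    using App[OF that] that by fastforce
  then show ?case by (simp add: UN_subset_iff)
qed auto

lemma fv_raise:
  "fv (raise N D \<chi>) \<subseteq> (\<lambda>i. i + N) ` fv \<chi> \<union> (if D = {} then {} else {0})"
proof (induction \<chi>)
  case (Eq s t)
  then show ?case using fv_raise_tm[of N D s] fv_raise_tm[of N D t]
    by (cases "D = {}") (simp_all add: image_Un, blast+)
next
  case (Rel r ts)
  have "fv_tm (raise_tm N D t) \<subseteq> (\<lambda>i. i + N) ` fv (Rel r ts) \<union> (if D = {} then {} else {0})"
    if "t \<in> set ts" for t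
    using fv_raise_tm[of N D t] that by fastforce
  then show ?case by (simp add: UN_subset_iff)
qed (auto split: if_splits)

lemma map_raise_tm:
  "map_tm id f (raise_tm N {} t) = raise_tm N {} (map_tm id f t)"
  by (induction t) auto

lemma map_raise: "map_fm id id f (raise N {} \<chi>) = raise N {} (map_fm id id f \<chi>)"
  by (induction \<chi>) (auto simp: map_raise_tm[unfolded id_def] id_def)

lemma map_tm_simps:
  "fv_tm (map_tm id f t) = fv_tm t"
  "wf_tm L (map_tm id f t) \<longleftrightarrow> wf_tm L t"
  by (induction t) auto

lemma map_fm_simps:
  "fv (map_fm id id f \<chi>) = fv \<chi>"
  "wf_fm L (map_fm id id f \<chi>) \<longleftrightarrow> wf_fm L \<chi>"
  by (induction \<chi>) (auto simp: map_tm_simps[unfolded id_def] id_def)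

lemma map_fm_fixed:
  assumes "\<And>a. a \<in> pars \<chi> \<Longrightarrow> f a = a"
  shows "map_fm id id f \<chi> = \<chi>"
proof -
  have "map_fm id id f \<chi> = map_fm id id id \<chi>"
    using assms by (intro fm.map_cong) auto
  then show ?thesis by (simp add: fm.map_id)
qed

text \<open>The formula \<open>\<chi>(t)\<close>, for a term \<open>t\<close> in the variables below \<open>N\<close>; quantifying instead of
  substituting avoids capture.\<close>

definition inst :: "nat \<Rightarrow> ('f, 'a) tm \<Rightarrow> ('f, 'r, 'a) fm \<Rightarrow> ('f, 'r, 'a) fm" where
  "inst N t \<chi> = Ex N (And (Eq (Var N) t) (raise N {} \<chi>))"

text \<open>The variable \<open>N\<close> does not occur in \<open>t\<close>, so the equation forces
  the witness of the quantifier to be the value of \<open>t\<close>. Since \<open>v\<close> is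
  arbitrary but quantifiers range over the carrier, membership of that value in the carrier remains
  as a conjunct.\<close>

lemma sat_inst:
  assumes "fv_tm t \<subseteq> {..<N}" and "fv \<chi> \<subseteq> {0}"
  shows "sat S v (inst N t \<chi>) \<longleftrightarrow> eval_tm S v t \<in> carrier S \<and> holds_at S \<chi> (eval_tm S v t)"
proof -
  have t: "eval_tm S (v(N := a)) t = eval_tm S v t" for a
    using assms(1) by (intro eval_tm_cong) auto
  have "sat S (v(N := a)) (raise N {} \<chi>) \<longleftrightarrow> holds_at S \<chi> a" for a
  proof -
    have "map_fm id id (\<lambda>a. if a \<in> {} then x else a) \<chi> = \<chi>" for x
      by (rule map_fm_fixed) simp
    then have "sat S (v(N := a)) (raise N {} \<chi>) \<longleftrightarrow> sat S (\<lambda>i. (v(N := a)) (i + N)) \<chi>"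
      by (simp add: sat_raise)
    \<comment> \<open>Only \<open>Var 0\<close> may be free in \<open>\<chi>\<close>; after the
      shift its value is read at index \<open>N\<close>, where it is \<open>a\<close>.\<close>
    also have "\<dots> \<longleftrightarrow> holds_at S \<chi> a"
      unfolding holds_at_def using assms(2) by (intro sat_cong) auto
    finally show ?thesis .
  qed
  with t show ?thesis by (auto simp: inst_def)
qed

lemma wf_inst: "wf_fm L (inst N t \<chi>) \<longleftrightarrow> wf_tm L t \<and> wf_fm L \<chi>"
  by (simp add: inst_def wf_raise)

lemma pars_inst: "pars (inst N t \<chi>) = tpars t \<union> pars \<chi>"
  by (simp add: inst_def pars_raise)

lemma fv_inst:
  assumes "fv \<chi> \<subseteq> {0}"
  shows "fv (inst N t \<chi>) \<subseteq> fv_tm t"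
proof -
  have "fv (raise N {} \<chi>) \<subseteq> {N}"
    using fv_raise[of N "{}" \<chi>] assms by fastforce
  then show ?thesis by (auto simp: inst_def)
qed

text \<open>Serves to show that an automorphism fixing the parameters of \<open>\<phi>\<close>
  carries \<phi>(x \<cdot> c) to the same formula with the image of \<open>c\<close> in place of
  \<open>c\<close>.\<close>

lemma map_inst:
  "map_fm id id f (inst N t \<chi>) = inst N (map_tm id f t) (map_fm id id f \<chi>)"
  by (simp add: inst_def map_raise[unfolded id_def] id_def)

text \<open>The unit is a closed formula, so that it contributes no free variable.\<close>

definition conjs :: "('f, 'r, 'a) fm list \<Rightarrow> ('f, 'r, 'a) fm" where
  "conjs \<psi>s = foldr And \<psi>s (Ex 0 (Eq (Var 0) (Var 0)))"

lemma sat_conjs: "carrier S \<noteq> {} \<Longrightarrow> sat S v (conjs \<psi>s) \<longleftrightarrow> (\<forall>\<psi>\<in>set \<psi>s. sat S v \<psi>)"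
  unfolding conjs_def by (induction \<psi>s) auto

lemma conjs_simps:
  "wf_fm L (conjs \<psi>s) \<longleftrightarrow> (\<forall>\<psi>\<in>set \<psi>s. wf_fm L \<psi>)"
  "pars (conjs \<psi>s) = (\<Union>\<psi>\<in>set \<psi>s. pars \<psi>)"
  "fv (conjs \<psi>s) = (\<Union>\<psi>\<in>set \<psi>s. fv \<psi>)"
  unfolding conjs_def by (induction \<psi>s) auto

lemma conjs_formulas_x: "set \<psi>s \<subseteq> formulas_x L A \<Longrightarrow> conjs \<psi>s \<in> formulas_x L A"
  unfolding formulas_x_def by (auto simp: conjs_simps)

section \<open>Blocks of existential quantifiers\<close>

fun exs :: "nat \<Rightarrow> ('f, 'r, 'a) fm \<Rightarrow> ('f, 'r, 'a) fm" where
  "exs 0 \<chi> = \<chi>"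
| "exs (Suc n) \<chi> = exs n (Ex n \<chi>)"

lemma sat_exs:
  "sat S v (exs n \<chi>) \<longleftrightarrow>
     (\<exists>w. (\<forall>i<n. w i \<in> carrier S) \<and> (\<forall>i\<ge>n. w i = v i) \<and> sat S w \<chi>)"
proof (induction n arbitrary: \<chi>)
  case 0
  have "w = v" if "\<forall>i. w i = v i" for w using that by auto
  then show ?case by auto
next
  case (Suc n)
  show ?case
  proof
    assume "sat S v (exs (Suc n) \<chi>)"
    then obtain w a where "\<forall>i<n. w i \<in> carrier S" "\<forall>i\<ge>n. w i = v i" "a \<in> carrier S"
      "sat S (w(n := a)) \<chi>"
      using Suc.IH[of "Ex n \<chi>"] by auto
    then show "\<exists>w. (\<forall>i<Suc n. w i \<in> carrier S) \<and> (\<forall>i\<ge>Suc n. w i = v i) \<and> sat S w \<chi>"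
      by (intro exI[of _ "w(n := a)"]) (auto simp: less_Suc_eq)
  next
    assume "\<exists>w. (\<forall>i<Suc n. w i \<in> carrier S) \<and> (\<forall>i\<ge>Suc n. w i = v i) \<and> sat S w \<chi>"
    then obtain w where w: "\<forall>i<Suc n. w i \<in> carrier S" "\<forall>i\<ge>Suc n. w i = v i" "sat S w \<chi>"
      by blast
    \<comment> \<open>Resetting index \<open>n\<close> to \<open>v n\<close> meets the agreement
      condition of the induction hypothesis, and \<open>Ex n\<close> gives back the value
      \<open>w n\<close>.\<close>
    have "sat S (w(n := v n)) (Ex n \<chi>)"
      using w by (auto intro!: bexI[of _ "w n"])
    moreover have "\<forall>i<n. (w(n := v n)) i \<in> carrier S" "\<forall>i\<ge>n. (w(n := v n)) i = v i"
      using w by auto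
    ultimately show "sat S v (exs (Suc n) \<chi>)"
      using Suc.IH[of "Ex n \<chi>"] by (metis exs.simps(2))
  qed
qed

lemma exs_simps:
  "wf_fm L (exs n \<chi>) \<longleftrightarrow> wf_fm L \<chi>"
  "pars (exs n \<chi>) = pars \<chi>"
  "fv (exs n \<chi>) = fv \<chi> - {..<n}"
  by (induction n arbitrary: \<chi>) (auto simp: less_Suc_eq)

section \<open>Elementary substructures\<close>

text \<open>Quantifying the variables below \<open>n\<close> in the conjunction of \<open>Q\<close>
  gives a single sentence over \<open>M\<close>, and this passes from \<open>N\<close> to
  \<open>M\<close>. All transfers of finite configurations below go through this lemma.\<close>

lemma elem_substructure_tuple:
  assumes "elem_substructure L M N"
    and "finite Q"
    and Q: "\<And>\<psi>. \<psi> \<in> Q \<Longrightarrow> wf_fm L \<psi> \<and> pars \<psi> \<subseteq> carrier M \<and> fv \<psi> \<subseteq> {..<n}"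
    and w: "\<And>i. i < n \<Longrightarrow> w i \<in> carrier N"
    and sat: "\<And>\<psi>. \<psi> \<in> Q \<Longrightarrow> sat N w \<psi>"
  obtains u where "\<And>i. i < n \<Longrightarrow> u i \<in> carrier M" and "\<And>\<psi>. \<psi> \<in> Q \<Longrightarrow> sat M u \<psi>"
proof -
  obtain \<psi>s where \<psi>s: "set \<psi>s = Q" using finite_list assms(2) by blast
  let ?\<chi> = "exs n (conjs \<psi>s)"
  obtain z where z: "z \<in> carrier M" and zN: "z \<in> carrier N"
    using assms(1) unfolding elem_substructure_def substructure_def is_structure_def by blast
  then have ne: "carrier M \<noteq> {}" "carrier N \<noteq> {}" by auto
  have snt: "?\<chi> \<in> sentences L (carrier M)"
    using Q \<psi>s unfolding sentences_def by (fastforce simp: exs_simps conjs_simps)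
  \<comment> \<open>From index \<open>n\<close> on the tuple is padded with \<open>z\<close>, so
    that it agrees there with the constant assignment at which the sentence is evaluated.\<close>
  let ?w = "\<lambda>i. if i < n then w i else z"
  have "sat N ?w \<psi>" if "\<psi> \<in> Q" for \<psi>
  proof -
    have "sat N ?w \<psi> \<longleftrightarrow> sat N w \<psi>"
      using Q[OF that] by (intro sat_cong) auto
    then show ?thesis using sat[OF that] by simp
  qed
  then have "sat N ?w (conjs \<psi>s)"
    using ne \<psi>s by (simp add: sat_conjs)
  then have "sat N (\<lambda>_. z) ?\<chi>"
    unfolding sat_exs using w by (intro exI[of _ ?w]) auto
  then have "models N ?\<chi>"
    using sat_sentence[OF snt, of "\<lambda>_. z" N] zN by auto
  then have "models M ?\<chi>"
    using assms(1) snt unfolding elem_substructure_def by blast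
  then have "sat M (\<lambda>_. z) ?\<chi>"
    using sat_sentence[OF snt, of "\<lambda>_. z" M] z by auto
  then show ?thesis
    unfolding sat_exs using that \<psi>s ne by (auto simp: sat_conjs)
qed

text \<open>Elementarity is stated for sentences, so the point enters as a parameter. The term
  \<open>Par a\<close> has no variables, which allows \<open>N = 0\<close> in
  \<open>inst\<close>.\<close>

lemma elem_substructure_holds_at:
  fixes M N :: "('a, 'f, 'r) fo_struct"
  assumes "elem_substructure L M N" and "\<psi> \<in> formulas_x L (carrier M)" and "a \<in> carrier M"
  shows "holds_at M \<psi> a \<longleftrightarrow> holds_at N \<psi> a"
proof -
  let ?\<chi> = "inst 0 (Par a) \<psi>"
  have aN: "a \<in> carrier N"
    using assms(1,3) unfolding elem_substructure_def substructure_def by blast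
  have fv: "fv \<psi> \<subseteq> {0}" using assms(2) by (simp add: formulas_x_def)
  have snt: "?\<chi> \<in> sentences L (carrier M)"
    using assms(2,3) fv_inst[OF fv, of 0 "Par a"]
    unfolding sentences_def formulas_x_def by (simp add: wf_inst pars_inst)
  have "models S ?\<chi> \<longleftrightarrow> holds_at S \<psi> a" if "a \<in> carrier S" for S :: "('a, 'f, 'r) fo_struct"
    using sat_sentence[OF snt, of "\<lambda>_. a" S] sat_inst[of "Par a" 0 \<psi> S "\<lambda>_. a"] fv that by auto
  then show ?thesis
    using assms(1,3) aN snt unfolding elem_substructure_def by blast
qed

text \<open>If \<open>N\<close> has exactly \<open>n\<close> solutions, then \<open>M\<close> also
  contains \<open>n\<close> distinct ones; these are solutions in \<open>N\<close>, so by counting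
  they are all of them. Contrapositively, a formula over \<open>M\<close> with a solution outside
  \<open>M\<close> has infinitely many.\<close>

lemma elem_substructure_finite_solutions:
  assumes "elem_substructure L M N" and "\<psi> \<in> formulas_x L (carrier M)"
    and "finite (solutions N \<psi>)"
  shows "solutions N \<psi> \<subseteq> carrier M"
proof -
  define n where "n = card (solutions N \<psi>)"
  obtain w where w: "bij_betw w {..<n} (solutions N \<psi>)"
    using ex_bij_betw_nat_finite[OF assms(3)] unfolding n_def atLeast0LessThan by blast
  have fv: "fv \<psi> \<subseteq> {0}" using assms(2) by (simp add: formulas_x_def)
  let ?Q = "(\<lambda>i. inst n (Var i) \<psi>) ` {..<n} \<union>
    (\<lambda>(i, j). Neg (Eq (Var i) (Var j))) ` {(i, j). i < n \<and> j < n \<and> i \<noteq> j}"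
  have "finite {(i, j). i < n \<and> j < n \<and> i \<noteq> j}"
    by (rule finite_subset[of _ "{..<n} \<times> {..<n}"]) auto
  then have fin: "finite ?Q" by blast
  have wsol: "w i \<in> carrier N \<and> holds_at N \<psi> (w i)" if "i < n" for i
    using w that unfolding bij_betw_def solutions_def by auto
  have inj: "w i \<noteq> w j" if "i < n" "j < n" "i \<noteq> j" for i j
    using w that unfolding bij_betw_def inj_on_def by auto
  have Q: "wf_fm L \<chi> \<and> pars \<chi> \<subseteq> carrier M \<and> fv \<chi> \<subseteq> {..<n}" if "\<chi> \<in> ?Q" for \<chi>
    using that
  proof
    assume "\<chi> \<in> (\<lambda>i. inst n (Var i) \<psi>) ` {..<n}"
    then obtain i where i: "i < n" "\<chi> = inst n (Var i) \<psi>" by blast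
    then show ?thesis
      using assms(2) fv_inst[OF fv, of n "Var i"] unfolding formulas_x_def
      by (auto simp: wf_inst pars_inst)
  qed auto
  have sat: "sat N w \<chi>" if "\<chi> \<in> ?Q" for \<chi>
    using that
  proof
    assume "\<chi> \<in> (\<lambda>i. inst n (Var i) \<psi>) ` {..<n}"
    then obtain i where i: "i < n" "\<chi> = inst n (Var i) \<psi>" by blast
    then show ?thesis using wsol[OF i(1)] fv by (simp add: sat_inst)
  qed (use inj in auto)
  obtain u where u: "\<And>i. i < n \<Longrightarrow> u i \<in> carrier M" "\<And>\<chi>. \<chi> \<in> ?Q \<Longrightarrow> sat M u \<chi>"
    by (rule elem_substructure_tuple[OF assms(1) fin Q _ sat]) (use wsol that in blast)+
  have "u i \<noteq> u j" if "i < n" "j < n" "i \<noteq> j" for i j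
    using u(2)[of "Neg (Eq (Var i) (Var j))"] that by force
  then have "inj_on u {..<n}" by (auto simp: inj_on_def)
  then have card: "card (u ` {..<n}) = card (solutions N \<psi>)"
    by (simp add: card_image n_def)
  have "u i \<in> solutions N \<psi>" if "i < n" for i
  proof -
    have "sat M u (inst n (Var i) \<psi>)" using u(2) that by blast
    then have "holds_at M \<psi> (u i)" using that fv by (simp add: sat_inst)
    moreover have "u i \<in> carrier N"
      using assms(1) u(1)[OF that] unfolding elem_substructure_def substructure_def by blast
    ultimately show ?thesis
      using elem_substructure_holds_at[OF assms(1,2) u(1)[OF that]] by (simp add: solutions_def)
  qed
  then have "u ` {..<n} \<subseteq> solutions N \<psi>" by auto
  from card_subset_eq[OF assms(3) this card] have eq: "solutions N \<psi> = u ` {..<n}" ..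
  show ?thesis unfolding eq using u(1) by auto
qed

section \<open>Types in the monster model\<close>

text \<open>Zorn's lemma gives a maximal finitely satisfiable set of formulas containing
  \<open>q\<close>, and maximality makes it complete.\<close>

lemma extend_to_type:
  assumes "q \<subseteq> formulas_x L A"
    and "\<And>r. finite r \<Longrightarrow> r \<subseteq> q \<Longrightarrow> \<exists>a\<in>carrier S. \<forall>\<psi>\<in>r. holds_at S \<psi> a"
  obtains p where "p \<in> types_over L S A" and "q \<subseteq> p"
proof -
  define fs where
    "fs p \<longleftrightarrow> (\<forall>r. finite r \<longrightarrow> r \<subseteq> p \<longrightarrow> (\<exists>a\<in>carrier S. \<forall>\<psi>\<in>r. holds_at S \<psi> a))" for p
  let ?F = "{p. q \<subseteq> p \<and> p \<subseteq> formulas_x L A \<and> fs p}"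
  have "\<exists>p\<in>?F. \<forall>X\<in>?F. p \<subseteq> X \<longrightarrow> X = p"
  proof (rule subset_Zorn_nonempty)
    show "?F \<noteq> {}" using assms unfolding fs_def by blast
    fix Ch assume Ch: "Ch \<noteq> {}" "subset.chain ?F Ch"
    then have sub: "Ch \<subseteq> ?F" unfolding subset.chain_def by blast
    have "fs (\<Union> Ch)"
      unfolding fs_def
    proof (intro allI impI)
      fix r assume "finite r" "r \<subseteq> \<Union> Ch"
      then obtain p where "p \<in> Ch" "r \<subseteq> p"
        using finite_subset_Union_chain[of r Ch ?F] Ch by metis
      then show "\<exists>a\<in>carrier S. \<forall>\<psi>\<in>r. holds_at S \<psi> a"
        using sub \<open>finite r\<close> unfolding fs_def by blast
    qed
    then show "\<Union> Ch \<in> ?F" using sub Ch(1) by blast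
  qed
  then obtain p where "p \<in> ?F" and maxF: "\<forall>X\<in>?F. p \<subseteq> X \<longrightarrow> X = p" ..
  then have p: "q \<subseteq> p" "p \<subseteq> formulas_x L A" "fs p" by simp_all
  have max: "X = p" if "X \<subseteq> formulas_x L A" "fs X" "p \<subseteq> X" for X
    using maxF[rule_format, of X] that p(1) by simp
  have "\<psi> \<in> p \<or> Neg \<psi> \<in> p" if \<psi>: "\<psi> \<in> formulas_x L A" for \<psi>
  proof (rule ccontr)
    assume no: "\<not> (\<psi> \<in> p \<or> Neg \<psi> \<in> p)"
    have neg: "Neg \<psi> \<in> formulas_x L A" using \<psi> unfolding formulas_x_def by simp
    have "\<not> fs (insert \<psi> p)" "\<not> fs (insert (Neg \<psi>) p)"
      using max[of "insert \<psi> p"] max[of "insert (Neg \<psi>) p"] no p(2) \<psi> neg by blast+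
    then obtain r s where r: "finite r" "r \<subseteq> insert \<psi> p"
        "\<And>a. a \<in> carrier S \<Longrightarrow> \<exists>\<chi>\<in>r. \<not> holds_at S \<chi> a"
      and s: "finite s" "s \<subseteq> insert (Neg \<psi>) p"
        "\<And>a. a \<in> carrier S \<Longrightarrow> \<exists>\<chi>\<in>s. \<not> holds_at S \<chi> a"
      unfolding fs_def by metis
    \<comment> \<open>What remains of the two unsatisfiable sets is a finite part of
      \<open>p\<close>. A point satisfying it would have to falsify both \<open>\<psi>\<close> and
      \<open>Neg \<psi>\<close>.\<close>
    have "finite ((r - {\<psi>}) \<union> (s - {Neg \<psi>}))" "(r - {\<psi>}) \<union> (s - {Neg \<psi>}) \<subseteq> p"
      using r s by auto
    then obtain a where a: "a \<in> carrier S"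
        "\<forall>\<chi>\<in>(r - {\<psi>}) \<union> (s - {Neg \<psi>}). holds_at S \<chi> a"
      using p(3) unfolding fs_def by meson
    have "\<not> holds_at S \<psi> a"
      using r(3)[OF a(1)] a(2) by (metis DiffI UnI1 singletonD)
    moreover have "\<not> holds_at S (Neg \<psi>) a"
      using s(3)[OF a(1)] a(2) by (metis DiffI UnI2 singletonD)
    ultimately show False by (simp add: holds_at_def)
  qed
  then have "p \<in> types_over L S A"
    using p unfolding types_over_def fs_def by blast
  then show ?thesis using that p(1) by blast
qed

text \<open>Otherwise completeness puts the negated conjunction into \<open>p\<close>, which
  contradicts finite satisfiability.\<close>

lemma type_conjs:
  assumes "p \<in> types_over L S A" and "set \<psi>s \<subseteq> p"
  shows "conjs \<psi>s \<in> p"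
proof (rule ccontr)
  assume no: "conjs \<psi>s \<notin> p"
  have "conjs \<psi>s \<in> formulas_x L A"
    using assms unfolding types_over_def by (intro conjs_formulas_x) blast
  then have "Neg (conjs \<psi>s) \<in> p"
    using assms(1) no unfolding types_over_def by blast
  then have "insert (Neg (conjs \<psi>s)) (set \<psi>s) \<subseteq> p" using assms(2) by blast
  then obtain a where a: "a \<in> carrier S" "holds_at S (Neg (conjs \<psi>s)) a"
      "\<forall>\<psi>\<in>set \<psi>s. holds_at S \<psi> a"
    using assms(1) unfolding types_over_def by (auto dest: spec[of _ "insert (Neg (conjs \<psi>s)) (set \<psi>s)"])
  moreover have "carrier S \<noteq> {}" using a(1) by blast
  ultimately show False
    unfolding holds_at_def by (simp add: sat_conjs)
qed

lemma small_Un_finite: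
  assumes "Card_order k" and "natLeq <o k" and "small k A" and "finite B"
  shows "small k (A \<union> B)"
proof -
  have "infinite (Field k)"
    using assms(1,2) cinfinite_mono[OF ordLess_imp_ordLeq natLeq_cinfinite]
    by (simp add: cinfinite_def)
  moreover have "|B| <o k"
    using assms(2,4) finite_iff_ordLess_natLeq ordLess_transitive by blast
  ultimately show ?thesis
    using assms(1,3) unfolding small_def by (intro card_of_Un_ordLess_infinite_Field)
qed

text \<open>Were there finitely many realizations, the type together with formulas excluding each of
  them would still be finitely satisfiable, because a conjunction from the type has infinitely many
  solutions. Saturation over \<open>M\<close> and these points would then produce a further
  realization.\<close>

lemma infinite_realizations:
  assumes k: "Card_order k" "natLeq <o k"
    and "saturated L k GG"
    and el: "elem_substructure L M GG" and "small k (carrier M)"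
    and c: "c \<in> carrier GG" "c \<notin> carrier M"
  shows "infinite {c'. realizes GG c' (tp L GG c (carrier M))}"
proof
  let ?R = "{c'. realizes GG c' (tp L GG c (carrier M))}"
  assume fin: "finite ?R"
  let ?A = "carrier M \<union> ?R"
  let ?q = "tp L GG c (carrier M) \<union> (\<lambda>r. Neg (Eq (Var 0) (Par r))) ` ?R"
  have A: "?A \<subseteq> carrier GG"
    using el unfolding elem_substructure_def substructure_def realizes_def by blast
  have small: "small k ?A"
    by (rule small_Un_finite[OF k assms(5) fin])
  have q: "?q \<subseteq> formulas_x L ?A"
    unfolding tp_def formulas_x_def by auto
  obtain p where p: "p \<in> types_over L GG ?A" "?q \<subseteq> p"
  proof (rule extend_to_type[OF q, of GG])
    fix r assume r: "finite r" "r \<subseteq> ?q"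
    \<comment> \<open>The formulas of \<open>r\<close> from the type of \<open>c\<close> are
      gathered into one conjunction; any other formula of \<open>r\<close> is an inequality,
      satisfied by every point outside \<open>?R\<close>.\<close>
    obtain \<psi>s where \<psi>s: "set \<psi>s = r \<inter> tp L GG c (carrier M)"
      using finite_list[OF finite_Int[OF disjI1[OF r(1)]]] ..
    have fx: "conjs \<psi>s \<in> formulas_x L (carrier M)"
      using \<psi>s unfolding tp_def by (intro conjs_formulas_x) blast
    have ne: "carrier GG \<noteq> {}" using c by blast
    then have "c \<in> solutions GG (conjs \<psi>s)"
      using c \<psi>s unfolding solutions_def tp_def holds_at_def by (simp add: sat_conjs)
    then have "infinite (solutions GG (conjs \<psi>s))"
      using elem_substructure_finite_solutions[OF el fx] c(2) by blast
    then have "\<not> solutions GG (conjs \<psi>s) \<subseteq> ?R"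
      using fin infinite_super by blast
    then obtain a where a: "a \<in> solutions GG (conjs \<psi>s)" "a \<notin> ?R" by blast
    have "holds_at GG \<psi> a" if "\<psi> \<in> r" for \<psi>
    proof (cases "\<psi> \<in> tp L GG c (carrier M)")
      case True
      then show ?thesis
        using a(1) that \<psi>s ne unfolding solutions_def holds_at_def by (simp add: sat_conjs)
    next
      case False
      then obtain d where "d \<in> ?R" "\<psi> = Neg (Eq (Var 0) (Par d))"
        using \<open>\<psi> \<in> r\<close> r(2) by blast
      then show ?thesis using a(2) by (auto simp: holds_at_def)
    qed
    then show "\<exists>a\<in>carrier GG. \<forall>\<psi>\<in>r. holds_at GG \<psi> a"
      using a(1) unfolding solutions_def by blast
  qed
  then obtain d where d: "realizes GG d p"
    using assms(3) A small unfolding saturated_def by blast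
  \<comment> \<open>Being a realization, \<open>d\<close> is among the excluded points, so
    \<open>p\<close> asserts that \<open>d\<close> differs from itself.\<close>
  then have "d \<in> ?R" using p(2) unfolding realizes_def by blast
  then have "Neg (Eq (Var 0) (Par d)) \<in> p" using p(2) by blast
  then show False using d unfolding realizes_def holds_at_def by fastforce
qed

text \<open>A sentence over \<open>M\<close> and \<open>c\<close> is a formula over \<open>M\<close>
  evaluated at \<open>c\<close>, and \<open>d\<close> satisfies the same such formulas. Hence the
  map fixing \<open>M\<close> and sending \<open>c\<close> to \<open>d\<close> is partial
  elementary, and strong homogeneity extends it.\<close>

lemma realization_conjugate:
  assumes "strongly_homogeneous L k S"
    and M: "M \<subseteq> carrier S" and c: "c \<in> carrier S" "c \<notin> M"
    and "small k (insert c M)"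
    and d: "realizes S d (tp L S c M)"
  obtains \<sigma> where "automorphism L S \<sigma>" and "\<And>a. a \<in> M \<Longrightarrow> \<sigma> a = a" and "\<sigma> c = d"
proof -
  let ?h = "\<lambda>a. if a \<in> {c} then d else a"
  have dS: "d \<in> carrier S" using d by (simp add: realizes_def)
  have "models S \<chi> \<longleftrightarrow> models S (map_fm id id ?h \<chi>)" if \<chi>: "\<chi> \<in> sentences L (insert c M)" for \<chi>
  proof -
    \<comment> \<open>The parameter \<open>c\<close> becomes \<open>Var 0\<close>; the shift by 1
      keeps every bound variable away from it.\<close>
    let ?\<psi> = "raise 1 {c} \<chi>"
    have \<psi>: "?\<psi> \<in> formulas_x L M"
      using \<chi> fv_raise[of 1 "{c}" \<chi>] unfolding sentences_def formulas_x_def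
      by (auto simp: wf_raise pars_raise)
    have at: "holds_at S ?\<psi> a \<longleftrightarrow> sat S (\<lambda>_. a) (map_fm id id (\<lambda>b. if b \<in> {c} then a else b) \<chi>)"
      for a unfolding holds_at_def by (simp add: sat_raise)
    have "map_fm id id (\<lambda>b. if b \<in> {c} then c else b) \<chi> = \<chi>"
      by (rule map_fm_fixed) simp
    then have "models S \<chi> \<longleftrightarrow> holds_at S ?\<psi> c"
      using at[of c] sat_sentence[OF \<chi>, of "\<lambda>_. c" S] c(1) by auto
    also have "\<dots> \<longleftrightarrow> holds_at S ?\<psi> d"
    proof
      assume "holds_at S ?\<psi> c"
      then show "holds_at S ?\<psi> d"
        using \<psi> d unfolding tp_def realizes_def by blast
    next
      assume R: "holds_at S ?\<psi> d"
      show "holds_at S ?\<psi> c"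
      proof (rule ccontr)
        assume "\<not> holds_at S ?\<psi> c"
        then have "Neg ?\<psi> \<in> tp L S c M"
          using \<psi> unfolding tp_def formulas_x_def holds_at_def by simp
        then have "holds_at S (Neg ?\<psi>) d" using d unfolding realizes_def by blast
        then show False using R by (simp add: holds_at_def)
      qed
    qed
    also have "\<dots> \<longleftrightarrow> models S (map_fm id id ?h \<chi>)"
    proof -
      have "fv (map_fm id id ?h \<chi>) = {}" "wf_fm L (map_fm id id ?h \<chi>)"
        using \<chi> unfolding sentences_def by (simp_all add: map_fm_simps)
      then have "map_fm id id ?h \<chi> \<in> sentences L UNIV"
        by (simp add: sentences_def)
      from sat_sentence[OF this, of "\<lambda>_. d" S] show ?thesis
        using at[of d] dS by auto
    qed
    finally show ?thesis .
  qed
  then have "partial_elementary L S (insert c M) ?h"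
    using M c(1) dS unfolding partial_elementary_def by auto
  then obtain \<sigma> where \<sigma>: "automorphism L S \<sigma>" "\<forall>a\<in>insert c M. \<sigma> a = ?h a"
    using assms(1,5) unfolding strongly_homogeneous_def by blast
  show ?thesis
  proof (rule that[OF \<sigma>(1)])
    show "\<sigma> a = a" if "a \<in> M" for a using \<sigma>(2) that c(2) by auto
    show "\<sigma> c = d" using \<sigma>(2) by simp
  qed
qed

section \<open>Finite productsets in the monster model and their descent to \<open>G\<close>\<close>

lemma infinite_conjs_solutions:
  assumes "p \<in> types_over L S A" and "nonalgebraic S p" and "finite q" and "q \<subseteq> p"
  shows "infinite {a \<in> carrier S. \<forall>\<psi>\<in>q. holds_at S \<psi> a}"
proof -
  obtain \<psi>s where \<psi>s: "set \<psi>s = q" using finite_list assms(3) by blast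
  \<comment> \<open>The conjunction of \<open>q\<close> is itself a member of the type, so
    nonalgebraicity applies to this one formula.\<close>
  then have "infinite (solutions S (conjs \<psi>s))"
    using type_conjs[OF assms(1)] assms(2,4) unfolding nonalgebraic_def by blast
  moreover have "solutions S (conjs \<psi>s) \<subseteq> {a \<in> carrier S. \<forall>\<psi>\<in>q. holds_at S \<psi> a}"
  proof
    fix a assume a: "a \<in> solutions S (conjs \<psi>s)"
    then have "carrier S \<noteq> {}" unfolding solutions_def by blast
    with a \<psi>s show "a \<in> {a \<in> carrier S. \<forall>\<psi>\<in>q. holds_at S \<psi> a}"
      by (simp add: solutions_def holds_at_def sat_conjs)
  qed
  ultimately show ?thesis by (rule infinite_super[rotated])
qed

text \<open>List \<open>B\<close> and \<open>C\<close> as one tuple of length \<open>2 * n\<close>.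
  Distinctness within each half, and \<phi> for every product across the halves, are finitely many
  formulas over \<open>G\<close>, so such a tuple exists in \<open>G\<close>.\<close>

lemma productset_descends:
  assumes el: "elem_substructure L G GG" and m: "m \<in> funs L" "farity L m = 2"
    and \<phi>: "\<phi> \<in> formulas_x L (carrier G)"
    and B: "finite B" "card B = n" "B \<subseteq> carrier GG"
    and C: "finite C" "card C = n" "C \<subseteq> carrier GG"
    and BC: "\<And>b c. b \<in> B \<Longrightarrow> c \<in> C \<Longrightarrow> holds_at GG \<phi> (fn GG m [b, c])"
  obtains B' C' where "B' \<subseteq> carrier G" and "C' \<subseteq> carrier G" and "card B' = n" and "card C' = n"
    and "\<And>b c. b \<in> B' \<Longrightarrow> c \<in> C' \<Longrightarrow> fn G m [b, c] \<in> solutions G \<phi>"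
proof -
  obtain e where e: "bij_betw e {..<n} B"
    using ex_bij_betw_nat_finite[OF B(1)] B(2) unfolding atLeast0LessThan by blast
  obtain f where f: "bij_betw f {..<n} C"
    using ex_bij_betw_nat_finite[OF C(1)] C(2) unfolding atLeast0LessThan by blast
  define w where "w i = (if i < n then e i else f (i - n))" for i
  have fv: "fv \<phi> \<subseteq> {0}" using \<phi> by (simp add: formulas_x_def)
  let ?I = "{..<n} \<times> {..<n} - Id"
  \<comment> \<open>The tuple occupies the variables below \<open>2 * n\<close>, so
    \<open>2 * n\<close> is the first index free for the quantifier in \<open>inst\<close>.\<close>
  let ?inst = "\<lambda>(i, j). inst (2 * n) (App m [Var i, Var (n + j)]) \<phi>"
  let ?Q = "?inst ` ({..<n} \<times> {..<n})
    \<union> (\<lambda>(i, j). Neg (Eq (Var i) (Var j))) ` ?I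
    \<union> (\<lambda>(i, j). Neg (Eq (Var (n + i)) (Var (n + j)))) ` ?I"
  have fin: "finite ?Q" by simp
  have eB: "e i \<in> B" if "i < n" for i using e that unfolding bij_betw_def by auto
  have fC: "f i \<in> C" if "i < n" for i using f that unfolding bij_betw_def by auto
  have w: "w i \<in> carrier GG" if "i < 2 * n" for i
    using eB[of i] fC[of "i - n"] B(3) C(3) that unfolding w_def by auto
  have Q1: "wf_fm L (?inst (i, j)) \<and> pars (?inst (i, j)) \<subseteq> carrier G \<and> fv (?inst (i, j)) \<subseteq> {..<2 * n}"
    if "i < n" "j < n" for i j
    using fv_inst[OF fv, of "2 * n" "App m [Var i, Var (n + j)]"] that m \<phi>
    unfolding formulas_x_def by (auto simp: wf_inst pars_inst)
  have Q: "wf_fm L \<chi> \<and> pars \<chi> \<subseteq> carrier G \<and> fv \<chi> \<subseteq> {..<2 * n}" if "\<chi> \<in> ?Q" for \<chi>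
    using that
  proof (elim UnE)
    assume "\<chi> \<in> ?inst ` ({..<n} \<times> {..<n})"
    then obtain i j where "i < n" "j < n" "\<chi> = ?inst (i, j)" by blast
    with Q1 show ?thesis by blast
  qed auto
  have mult: "fn GG m [b, c] \<in> carrier GG" if "b \<in> carrier GG" "c \<in> carrier GG" for b c
    using el m that unfolding elem_substructure_def substructure_def is_structure_def by auto
  have sat1: "sat GG w (?inst (i, j))" if "i < n" "j < n" for i j
    using that fv BC[OF eB fC] mult[OF subsetD[OF B(3) eB] subsetD[OF C(3) fC]]
    by (simp add: sat_inst w_def)
  have "inj_on w {..<n}" "inj_on (\<lambda>i. w (n + i)) {..<n}"
    using e f unfolding w_def bij_betw_def inj_on_def by auto
  note inj = this[THEN inj_onD]
  have sat: "sat GG w \<chi>" if "\<chi> \<in> ?Q" for \<chi>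
    using that
  proof (elim UnE)
    assume "\<chi> \<in> ?inst ` ({..<n} \<times> {..<n})"
    then obtain i j where "i < n" "j < n" "\<chi> = ?inst (i, j)" by blast
    with sat1 show ?thesis by blast
  qed (auto dest: inj)
  obtain u where u: "\<And>i. i < 2 * n \<Longrightarrow> u i \<in> carrier G" "\<And>\<chi>. \<chi> \<in> ?Q \<Longrightarrow> sat G u \<chi>"
    by (rule elem_substructure_tuple[OF el fin Q w sat]) (assumption | rule that)+
  have inst: "fn G m [u i, u (n + j)] \<in> solutions G \<phi>" if "i < n" "j < n" for i j
  proof -
    have "sat G u (?inst (i, j))" using u(2) that by blast
    then show ?thesis using fv that by (simp add: sat_inst solutions_def)
  qed
  have neq: "u i \<noteq> u j \<and> u (n + i) \<noteq> u (n + j)" if "i < n" "j < n" "i \<noteq> j" for i j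
  proof -
    have ij: "(i, j) \<in> ?I" using that by simp
    have eq1: "Neg (Eq (Var i) (Var j)) \<in> ?Q"
      by (rule UnI1, rule UnI2, rule rev_image_eqI[OF ij], simp)
    have eq2: "Neg (Eq (Var (n + i)) (Var (n + j))) \<in> ?Q"
      by (rule UnI2, rule rev_image_eqI[OF ij], simp)
    show ?thesis using u(2)[OF eq1] u(2)[OF eq2] by simp
  qed
  show ?thesis
  proof (rule that[of "u ` {..<n}" "(\<lambda>j. u (n + j)) ` {..<n}"])
    have "inj_on u {..<n}" "inj_on (\<lambda>j. u (n + j)) {..<n}"
      using neq unfolding inj_on_def by blast+
    then show "card (u ` {..<n}) = n" "card ((\<lambda>j. u (n + j)) ` {..<n}) = n"
      by (simp_all add: card_image)
  qed (use u(1) inst in auto)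
qed

theorem theorem3p29:
  fixes L :: "('f, 'r) language"
    and m :: 'f
    and k :: "'k rel"
    and G GG :: "('a, 'f, 'r) fo_struct"
    and T :: "('f, 'r, 'a) fm set"
    and \<phi> :: "('f, 'r, 'a) fm"
  assumes "expands_group L m G"
    and "T = theory_of L G"
    and "monster_model L k T GG"
    and "elem_substructure L G GG"
    and "small k (carrier G)"
    and "\<phi> \<in> formulas_x L (carrier G)"
    and "gs_substantial L m k G GG \<phi>"
  shows "finitary_productset_property m G \<phi>"
proof -
  have m: "m \<in> funs L" "farity L m = 2"
    using assms(1) unfolding expands_group_def by auto
  have k: "Card_order k" "natLeq <o k" and sat: "saturated L k GG"
    and hom: "strongly_homogeneous L k GG" and str: "is_structure L GG"
    using assms(3) unfolding monster_model_def by auto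
  have fv: "fv \<phi> \<subseteq> {0}" and wf: "wf_fm L \<phi>" and parG: "pars \<phi> \<subseteq> carrier G"
    using assms(6) by (auto simp: formulas_x_def)
  obtain M b c p where M: "elem_substructure L M GG" "small k (carrier M)"
    and parM: "pars \<phi> \<subseteq> carrier M"
    and b: "b \<in> carrier GG" and c: "c \<in> carrier GG" "c \<notin> carrier M"
    and hold: "holds_at GG \<phi> (fn GG m [b, c])"
    and p: "p \<in> types_over L GG (carrier GG)" "tp L GG b (carrier G \<union> {c}) \<subseteq> p"
      "nonalgebraic GG p" "invariant_over L GG (carrier M) p"
    using assms(7) unfolding gs_substantial_def generically_stable_def
    by (auto simp: group_reduct_def)
  have MGG: "carrier M \<subseteq> carrier GG"
    using M(1) unfolding elem_substructure_def substructure_def by blast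
  have mult: "fn GG m [x, y] \<in> carrier GG" if "x \<in> carrier GG" "y \<in> carrier GG" for x y
    using str m that unfolding is_structure_def by auto
  \<comment> \<open>This is the formula \<phi>(x \<cdot> d), with \<open>d\<close> as a
    parameter.\<close>
  define \<phi>c where "\<phi>c d = inst 1 (App m [Var 0, Par d]) \<phi>" for d
  have holds_\<phi>c: "holds_at GG (\<phi>c d) a \<longleftrightarrow> fn GG m [a, d] \<in> carrier GG \<and> holds_at GG \<phi> (fn GG m [a, d])"
    for a d unfolding \<phi>c_def holds_at_def[of GG "inst _ _ _"] using fv by (simp add: sat_inst)
  have "\<phi>c c \<in> formulas_x L (carrier G \<union> {c})"
    using m wf parG fv_inst[OF fv, of 1 "App m [Var 0, Par c]"]
    unfolding formulas_x_def \<phi>c_def by (auto simp: wf_inst pars_inst)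
  \<comment> \<open>The point \<open>b\<close> satisfies this formula over \<open>G\<close> and
    \<open>c\<close>, and \<open>p\<close> extends the type of \<open>b\<close> over these
    parameters.\<close>
  then have c_in: "\<phi>c c \<in> p"
    using p(2) hold holds_\<phi>c mult[OF b c(1)] unfolding tp_def by blast
  let ?R = "{d. realizes GG d (tp L GG c (carrier M))}"
  have in_p: "\<phi>c d \<in> p" if "d \<in> ?R" for d
  proof -
    have "small k (insert c (carrier M))"
      using small_Un_finite[OF k M(2), of "{c}"] by simp
    then obtain \<sigma> where \<sigma>: "automorphism L GG \<sigma>" "\<And>a. a \<in> carrier M \<Longrightarrow> \<sigma> a = a" "\<sigma> c = d"
      using realization_conjugate[OF hom MGG c] \<open>d \<in> ?R\<close> by blast
    \<comment> \<open>The automorphism fixes \<open>M\<close> pointwise, so it preserves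
      \<open>p\<close> by invariance. It also fixes \<open>\<phi>\<close>, whose parameters lie in
      \<open>M\<close>, and thus turns \<open>\<phi>c c\<close> into
      \<open>\<phi>c d\<close>.\<close>
    have "map_fm id id \<sigma> (\<phi>c c) \<in> p"
      using p(4) \<sigma>(1,2) c_in unfolding invariant_over_def by blast
    moreover have "map_fm id id \<sigma> \<phi> = \<phi>"
      using parM \<sigma>(2) by (intro map_fm_fixed) blast
    ultimately show ?thesis
      using \<sigma>(3) by (simp add: \<phi>c_def map_inst)
  qed
  have "\<exists>B C. B \<subseteq> carrier G \<and> C \<subseteq> carrier G \<and>
        (infinite B \<or> n \<le> card B) \<and> (infinite C \<or> n \<le> card C) \<and>
        B <#>\<^bsub>group_reduct m G\<^esub> C \<subseteq> solutions G \<phi>" for n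
  proof -
    \<comment> \<open>First \<open>C\<close> is chosen among the realizations of the type of
      \<open>c\<close> over \<open>M\<close>; then \<open>B\<close> is taken from the common
      solutions of the formulas \<open>\<phi>c d\<close> with \<open>d\<close> in \<open>C\<close>,
      all of which belong to \<open>p\<close>.\<close>
    obtain C where C: "finite C" "card C = n" "C \<subseteq> ?R"
      using infinite_arbitrarily_large[OF infinite_realizations[OF k sat M c]] by blast
    have infB: "infinite {a \<in> carrier GG. \<forall>\<psi>\<in>\<phi>c ` C. holds_at GG \<psi> a}"
      using C in_p by (intro infinite_conjs_solutions[OF p(1,3)]) auto
    obtain B where B: "finite B" "card B = n"
        "B \<subseteq> {a \<in> carrier GG. \<forall>\<psi>\<in>\<phi>c ` C. holds_at GG \<psi> a}"
      using infinite_arbitrarily_large[OF infB] by blast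
    have BGG: "B \<subseteq> carrier GG" using B(3) by blast
    have CGG: "C \<subseteq> carrier GG" using C(3) unfolding realizes_def by blast
    have "holds_at GG \<phi> (fn GG m [x, y])" if "x \<in> B" "y \<in> C" for x y
      using B(3) that holds_\<phi>c by blast
    from productset_descends[OF assms(4) m assms(6) B(1,2) BGG C(1,2) CGG this]
    obtain B' C' where "B' \<subseteq> carrier G" "C' \<subseteq> carrier G" "card B' = n" "card C' = n"
        "\<And>x y. x \<in> B' \<Longrightarrow> y \<in> C' \<Longrightarrow> fn G m [x, y] \<in> solutions G \<phi>"
      by blast
    then show ?thesis
      by (intro exI[of _ B'] exI[of _ C']) (auto simp: set_mult_def group_reduct_def)
  qed
  then show ?thesis unfolding finitary_productset_property_def by blast
qed

end
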